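(* There is no $2$-connected nontrivial uniquely $C_9$-saturated graph whose longest even cycle of length at most $12$ is an $8$-cycle.
   Context: All graphs are finite and simple. A graph $G$ is uniquely $C_9$-saturated if it contains no cycle of length $9$ and, for every edge $e$ of the complement $\overline{G}$, $G+e$ contains exactly one cycle of length $9$; it is nontrivial if $|V(G)|\ge 9$. "Longest even cycle of length at most $12$" means a longest cycle among all even cycles of $G$ whose length is at most $12$; so the condition says that $G$ contains an $8$-cycle but no cycle of length $10$ or $12$. *)

theory Defs
  imports Main
begin

definition all_edges :: "'a set \<Rightarrow> 'a set set" where
  "all_edges V = {e. e \<subseteq> V \<and> card e = 2}"

definition simple_graph :: "'a set \<Rightarrow> 'a set set \<Rightarrow> bool" where
  "simple_graph V E \<longleftrightarrow> finite V \<and> E \<subseteq> all_edges V"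

definition complement_edges :: "'a set \<Rightarrow> 'a set set \<Rightarrow> 'a set set" where
  "complement_edges V E = all_edges V - E"

definition connected_graph :: "'a set \<Rightarrow> 'a set set \<Rightarrow> bool" where
  "connected_graph V E \<longleftrightarrow>
     V \<noteq> {} \<and> (\<forall>u\<in>V. \<forall>v\<in>V. (u, v) \<in> {(x, y). x \<in> V \<and> y \<in> V \<and> {x, y} \<in> E}\<^sup>*)"

definition k_connected :: "nat \<Rightarrow> 'a set \<Rightarrow> 'a set set \<Rightarrow> bool" where
  "k_connected k V E \<longleftrightarrow>
     card V > k \<and>
     (\<forall>X. X \<subseteq> V \<and> card X < k \<longrightarrow> connected_graph (V - X) {e \<in> E. e \<inter> X = {}})"

definition cycle_edges :: "'a list \<Rightarrow> 'a set set" where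
  "cycle_edges xs = {{xs ! i, xs ! (Suc i mod length xs)} | i. i < length xs}"

(* A cycle is a subgraph, represented by its edge set. All rotations and reversals of a
   vertex list give the same edge set, so counting the sets C counts cycles as subgraphs. *)
definition is_cycle :: "'a set \<Rightarrow> 'a set set \<Rightarrow> nat \<Rightarrow> 'a set set \<Rightarrow> bool" where
  "is_cycle V E k C \<longleftrightarrow>
     k \<ge> 3 \<and>
     (\<exists>xs. distinct xs \<and> length xs = k \<and> set xs \<subseteq> V \<and> cycle_edges xs \<subseteq> E \<and> C = cycle_edges xs)"

definition uniquely_cycle_saturated :: "nat \<Rightarrow> 'a set \<Rightarrow> 'a set set \<Rightarrow> bool" where
  "uniquely_cycle_saturated k V E \<longleftrightarrow>
     (\<nexists>C. is_cycle V E k C) \<and>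
     (\<forall>e \<in> complement_edges V E. \<exists>!C. is_cycle V (insert e E) k C)"

definition nontrivial_for_cycle :: "nat \<Rightarrow> 'a set \<Rightarrow> bool" where
  "nontrivial_for_cycle k V \<longleftrightarrow> card V \<ge> k"

(* Among the even cycles of length at most m there is a longest one, and it has length k. *)
definition longest_even_cycle_upto :: "nat \<Rightarrow> 'a set \<Rightarrow> 'a set set \<Rightarrow> nat \<Rightarrow> bool" where
  "longest_even_cycle_upto m V E k \<longleftrightarrow>
     even k \<and> k \<le> m \<and> (\<exists>C. is_cycle V E k C) \<and>
     (\<forall>j C. even j \<and> j \<le> m \<and> is_cycle V E j C \<longrightarrow> j \<le> k)"

end

theory Submission
  imports Defs
begin

text \<open>
  The proof rests on one consequence of unique saturation: any two vertices are joined by at most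
  one path with eight edges.  Adjacent vertices are joined by none, since such a path would close
  to a 9-cycle, and nonadjacent vertices by exactly one.  So two different eight-edge paths with
  common ends refute a configuration, and so do a 9-cycle and a 10-cycle, the latter because the
  longest even cycle of length at most 12 is an 8-cycle.

  The graph contains an 8-cycle and, having at least nine vertices, something outside it.  By
  2-connectedness there is an ear: a path with two different ends on the 8-cycle and at
  least one inner vertex, all inner vertices lying outside.  The theorem follows because an
  8-cycle has no ear (\<open>no_ear\<close>).

  Long ears fall to \<open>outside_depth\<close>: four consecutive outside vertices reached from a vertex
  \<open>a\<close> of the 8-cycle end in a vertex that the antipode of \<open>a\<close> reaches by two eight-edge paths, one
  around each side of the 8-cycle.  Thus an ear has at most four edges.  Let it have \<open>l\<close> edges and
  let its ends have distance \<open>d\<close> on the 8-cycle.  For most pairs \<open>(l, d)\<close> with \<open>l \<le> 4\<close> a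
  9-cycle, a 10-cycle or a pair of eight-edge paths is visible at once.  Four pairs survive:
  \<open>(3, 4)\<close>, \<open>(4, 1)\<close>, \<open>(2, 4)\<close> and \<open>(2, 3)\<close>.  In each of them the 8-cycle and the ear form a theta
  graph, that is, three paths between two hubs, and here the existence half of saturation enters: some
  nonadjacent pair must be joined by an eight-edge path, but further chords and further ears of the theta
  graph clash so often that such a path has no room.  The order of the four cases matters.  Once
  ears with three and four edges are gone, an eight-edge path between vertices of the 8-cycle
  steps outside only for one vertex at a time, so that in the last two cases it would have to be
  a Hamiltonian path of a nine-vertex theta graph with a few chords.
\<close>

section \<open>Graphs with at most one eight-edge path between two vertices\<close>

text \<open>
  The path axioms are negated conjunctions so that an instance at explicit vertex lists
  simplifies to a statement about single edges and inequalities.  In \<open>saturated\<close>, the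
  neighbours \<open>u'\<close> and \<open>v'\<close> witness that \<open>u\<close> and \<open>v\<close> are vertices, which avoids carrying
  a vertex set.
\<close>

locale unique_eight_paths =
  fixes adj :: "'a \<Rightarrow> 'a \<Rightarrow> bool"
  assumes adj_commute: "adj x y \<longleftrightarrow> adj y x"
    and adj_irrefl [simp]: "\<not> adj x x"
    and no_cycle9: "\<not> (length p = 9 \<and> distinct p \<and> successively adj p \<and> adj (last p) (hd p))"
    and no_cycle10: "\<not> (length p = 10 \<and> distinct p \<and> successively adj p \<and> adj (last p) (hd p))"
    and unique_path: "\<not> (length p = 9 \<and> distinct p \<and> successively adj p \<and>
      length q = 9 \<and> distinct q \<and> successively adj q \<and> hd p = hd q \<and> last p = last q \<and> p \<noteq> q)"
    and saturated: "\<lbrakk>adj u u'; adj v v'; u \<noteq> v; \<not> adj u v\<rbrakk> \<Longrightarrow>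
      \<exists>p. distinct p \<and> successively adj p \<and> length p = 9 \<and> hd p = u \<and> last p = v"
begin

definition octagon :: "'a list \<Rightarrow> bool" where
  "octagon c \<longleftrightarrow> length c = 8 \<and> distinct c \<and> successively adj c \<and> adj (last c) (hd c)"

lemma octagon_rotate: "octagon (x # xs) \<Longrightarrow> octagon (xs @ [x])"
  by (cases xs)
    (auto simp: octagon_def successively_append_iff successively_Cons adj_commute[of x] hd_append)

lemma octagon_rotate_append: "octagon (xs @ ys) \<Longrightarrow> octagon (ys @ xs)"
proof (induction xs arbitrary: ys)
  case (Cons x xs)
  then show ?case using octagon_rotate[of x "xs @ ys"] Cons.IH[of "ys @ [x]"] by simp
qed simp

lemma octagon_mirror:
  "octagon [v0,v1,v2,v3,v4,v5,v6,v7] \<Longrightarrow> octagon [v0,v7,v6,v5,v4,v3,v2,v1]"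
  by (auto simp: octagon_def adj_commute)

text \<open>
  Cutting the cyclic list at \<open>a\<close> lets every later argument speak of eight named vertices.
\<close>

lemma octagon_from:
  assumes "octagon c" "a \<in> set c"
  obtains v1 v2 v3 v4 v5 v6 v7
  where "octagon [a,v1,v2,v3,v4,v5,v6,v7]" "set c = set [a,v1,v2,v3,v4,v5,v6,v7]"
proof -
  obtain xs ys where c: "c = xs @ a # ys" using assms(2) by (meson split_list)
  then have o: "octagon (a # ys @ xs)" using assms(1) octagon_rotate_append[of xs "a # ys"] by simp
  then have "length (ys @ xs) = 7" by (simp add: octagon_def)
  then obtain v1 v2 v3 v4 v5 v6 v7 where v: "ys @ xs = [v1,v2,v3,v4,v5,v6,v7]"
    by (auto simp: eval_nat_numeral length_Suc_conv simp del: length_append)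
  have "set c = set (a # ys @ xs)" using c by auto
  then show thesis using that o unfolding v by blast
qed

text \<open>
  Of the two directions of travel from \<open>a\<close>, one reaches \<open>b\<close> within four steps; this removes
  the mirror images from all case distinctions on ears.
\<close>

lemma octagon_from_within_distance4:
  assumes "octagon c" "a \<in> set c" "b \<in> set c" "a \<noteq> b"
  obtains v1 v2 v3 v4 v5 v6 v7
  where "octagon [a,v1,v2,v3,v4,v5,v6,v7]" "set c = set [a,v1,v2,v3,v4,v5,v6,v7]"
    "b \<in> {v1,v2,v3,v4}"
proof -
  obtain v1 v2 v3 v4 v5 v6 v7 where
    o: "octagon [a,v1,v2,v3,v4,v5,v6,v7]" and s: "set c = set [a,v1,v2,v3,v4,v5,v6,v7]"
    using octagon_from assms by metis
  show thesis
  proof (cases "b \<in> {v1,v2,v3,v4}")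
    case True
    with that o s show thesis by blast
  next
    case False
    then have "b \<in> {v7,v6,v5,v4}" using assms s by auto
    moreover have "set c = set [a,v7,v6,v5,v4,v3,v2,v1]" using s by auto
    ultimately show thesis using that octagon_mirror[OF o] by blast
  qed
qed

section \<open>Ears of an 8-cycle: lengths and distances\<close>

text \<open>
  The antipode of \<open>a\<close> is four steps away from \<open>a\<close> in both directions, so it reaches \<open>w\<close>
  by two different eight-edge paths.
\<close>

lemma outside_depth:
  assumes c: "octagon c" "a \<in> set c" and p: "distinct [a,x,y,z,w]" "successively adj [a,x,y,z,w]"
    and out: "{x,y,z,w} \<inter> set c = {}"
  shows False
proof -
  obtain v1 v2 v3 v4 v5 v6 v7 where
    o: "octagon [a,v1,v2,v3,v4,v5,v6,v7]" and s: "set c = set [a,v1,v2,v3,v4,v5,v6,v7]"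
    using octagon_from[OF c] by blast
  show False
    using unique_path[of "[v4,v3,v2,v1,a,x,y,z,w]" "[v4,v5,v6,v7,a,x,y,z,w]"] o p out s
    by (auto simp: octagon_def adj_commute)
qed

text \<open>
  A two-edge ear joins vertices at distance 3 or 4: distance 1 gives a 9-cycle, and at
  distance 2 the detour through \<open>x\<close> makes a second 8-cycle.
\<close>

lemma ear2_ends:
  assumes "octagon [v0,v1,v2,v3,v4,v5,v6,v7]" "x \<notin> set [v0,v1,v2,v3,v4,v5,v6,v7]" "adj v0 x"
  shows "\<not> adj x v1" "\<not> adj x v2" "\<not> adj x v6" "\<not> adj x v7"
proof -
  note facts = assms[unfolded octagon_def] adj_commute
  show "\<not> adj x v1" using no_cycle9[of "[v0,v7,v6,v5,v4,v3,v2,v1,x]"] facts by auto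
  show "\<not> adj x v2"
    using unique_path[of "[v1,v0,v7,v6,v5,v4,v3,v2,x]" "[v1,v2,v3,v4,v5,v6,v7,v0,x]"] facts by auto
  show "\<not> adj x v6"
    using unique_path[of "[v7,v0,v1,v2,v3,v4,v5,v6,x]" "[v7,v6,v5,v4,v3,v2,v1,v0,x]"] facts by auto
  show "\<not> adj x v7" using no_cycle9[of "[v0,v1,v2,v3,v4,v5,v6,v7,x]"] facts by auto
qed

text \<open>
  A three-edge ear joins antipodal vertices.  Distances 1 and 2 give a 10-cycle and a 9-cycle;
  at distance 3 the ear is exchangeable with the short side of the 8-cycle.
\<close>

lemma ear3_ends:
  assumes "octagon [v0,v1,v2,v3,v4,v5,v6,v7]" "x \<notin> set [v0,v1,v2,v3,v4,v5,v6,v7]"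
    "y \<notin> set [v0,v1,v2,v3,v4,v5,v6,v7]" "adj v0 x" "adj x y"
  shows "\<not> adj y v1" "\<not> adj y v2" "\<not> adj y v3"
proof -
  have "x \<noteq> y" using assms(5) by auto
  note facts = assms[unfolded octagon_def] this adj_commute
  show "\<not> adj y v1" using no_cycle10[of "[v0,v7,v6,v5,v4,v3,v2,v1,y,x]"] facts by auto
  show "\<not> adj y v2" using no_cycle9[of "[v0,v7,v6,v5,v4,v3,v2,y,x]"] facts by auto
  show "\<not> adj y v3"
    using unique_path[of "[v1,v0,v7,v6,v5,v4,v3,y,x]" "[v1,v2,v3,v4,v5,v6,v7,v0,x]"] facts by auto
qed

text \<open>
  A four-edge ear joins consecutive vertices.  Distances 2 and 3 give a 10-cycle and a 9-cycle;
  at distance 4 the ear is exchangeable with either half of the 8-cycle.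
\<close>

lemma ear4_ends:
  assumes "octagon [v0,v1,v2,v3,v4,v5,v6,v7]" "distinct [x,y,z]"
    "{x,y,z} \<inter> set [v0,v1,v2,v3,v4,v5,v6,v7] = {}" "adj v0 x" "adj x y" "adj y z"
  shows "\<not> adj z v2" "\<not> adj z v3" "\<not> adj z v4"
proof -
  note facts = assms[unfolded octagon_def] adj_commute
  show "\<not> adj z v2" using no_cycle10[of "[v0,v7,v6,v5,v4,v3,v2,z,y,x]"] facts by auto
  show "\<not> adj z v3" using no_cycle9[of "[v0,v7,v6,v5,v4,v3,z,y,x]"] facts by auto
  show "\<not> adj z v4"
    using unique_path[of "[v1,v0,v7,v6,v5,v4,z,y,x]" "[v1,v2,v3,v4,v5,v6,v7,v0,x]"] facts by auto
qed

section \<open>No ear with three edges\<close>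

text \<open>
  In the theta graph with sides of 3, 4 and 4 edges, every additional neighbour of the inner
  vertices of a long side clashes.  The mirror images of the two claims cover all six inner
  vertices of the long sides.
\<close>

lemma theta344_degree_two:
  assumes "octagon [v0,v1,v2,v3,v4,v5,v6,v7]" "x \<notin> set [v0,v1,v2,v3,v4,v5,v6,v7]"
    "y \<notin> set [v0,v1,v2,v3,v4,v5,v6,v7]"
    "adj v0 x" "adj x y" "adj y v4"
  shows "adj v1 w \<Longrightarrow> w = v0 \<or> w = v2" "adj v2 w \<Longrightarrow> w = v1 \<or> w = v3"
proof -
  have "x \<noteq> y" using assms(5) by auto
  note facts = assms[unfolded octagon_def] this adj_commute
  have "\<not> adj v1 v3"
    using unique_path[of "[v2,v1,v0,v7,v6,v5,v4,y,x]" "[v2,v1,v3,v4,v5,v6,v7,v0,x]"] facts by auto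
  moreover have "\<not> adj v1 v4"
    using unique_path[of "[v2,v1,v4,v5,v6,v7,v0,x,y]" "[v2,v3,v4,v5,v6,v7,v0,x,y]"] facts by auto
  moreover have "\<not> adj v1 v5"
    using no_cycle10[of "[v0,v7,v6,v5,v1,v2,v3,v4,y,x]"] facts by auto
  moreover have "\<not> adj v1 v6"
    using no_cycle9[of "[v0,v7,v6,v1,v2,v3,v4,y,x]"] facts by auto
  moreover have "\<not> adj v1 v7"
    using unique_path[of "[v2,v1,v0,v7,v6,v5,v4,y,x]" "[v2,v3,v4,v5,v6,v7,v1,v0,x]"] facts by auto
  moreover have "\<not> adj v1 x"
    using no_cycle9[of "[v0,v7,v6,v5,v4,v3,v2,v1,x]"] facts by auto
  moreover have "\<not> adj v1 y"
    using no_cycle10[of "[v0,v7,v6,v5,v4,v3,v2,v1,y,x]"] facts by auto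
  moreover have "adj v1 w \<Longrightarrow> w \<in> insert x (insert y (set [v0,v1,v2,v3,v4,v5,v6,v7]))"
    using unique_path[of "[v7,v0,x,y,v4,v3,v2,v1,w]" "[v7,v6,v5,v4,y,x,v0,v1,w]"] facts by auto
  ultimately show "adj v1 w \<Longrightarrow> w = v0 \<or> w = v2" by auto
  have "\<not> adj v2 v0"
    using unique_path[of "[v1,v2,v0,v7,v6,v5,v4,y,x]" "[v1,v2,v3,v4,v5,v6,v7,v0,x]"] facts by auto
  moreover have "\<not> adj v2 v4"
    using unique_path[of "[v3,v2,v1,v0,v7,v6,v5,v4,y]" "[v3,v2,v4,v5,v6,v7,v0,x,y]"] facts by auto
  moreover have "\<not> adj v2 v5"
    using no_cycle9[of "[v0,v7,v6,v5,v2,v3,v4,y,x]"] facts by auto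
  moreover have "\<not> adj v2 v6"
    using unique_path[of "[v1,v0,v7,v6,v2,v3,v4,y,x]" "[v1,v2,v3,v4,v5,v6,v7,v0,x]"] facts by auto
  moreover have "\<not> adj v2 v7"
    using no_cycle9[of "[v0,v1,v2,v7,v6,v5,v4,y,x]"] facts by auto
  moreover have "\<not> adj v2 x"
    using no_cycle9[of "[v0,v1,v2,x,y,v4,v5,v6,v7]"] facts by auto
  moreover have "\<not> adj v2 y"
    using no_cycle9[of "[v0,v7,v6,v5,v4,v3,v2,y,x]"] facts by auto
  moreover have "adj v2 w \<Longrightarrow> w \<in> insert x (insert y (set [v0,v1,v2,v3,v4,v5,v6,v7]))"
    using unique_path[of "[v6,v5,v4,y,x,v0,v1,v2,w]" "[v6,v7,v0,x,y,v4,v3,v2,w]"] facts by auto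
  ultimately show "adj v2 w \<Longrightarrow> w = v1 \<or> w = v3" by auto
qed

text \<open>
  Only the antipodal case is left.  An eight-edge path from \<open>v2\<close> to \<open>a\<close> cannot pass \<open>v1\<close>, so it
  starts \<open>v2\<close>, \<open>v3\<close>, \<open>v4\<close>.  Continuing along \<open>v5\<close>, \<open>v6\<close>, \<open>v7\<close> it would reach \<open>a\<close> too early, and
  otherwise the degrees keep it outside the 8-cycle for longer than \<open>outside_depth\<close> allows.
\<close>

lemma no_ear3:
  assumes c: "octagon c" "a \<in> set c" "b \<in> set c" "a \<noteq> b"
    and out: "x \<notin> set c" "y \<notin> set c" and adj: "adj a x" "adj x y" "adj y b"
  shows False
proof -
  obtain v1 v2 v3 v4 v5 v6 v7 where o: "octagon [a,v1,v2,v3,v4,v5,v6,v7]"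
    and s: "set c = set [a,v1,v2,v3,v4,v5,v6,v7]" and b: "b \<in> {v1,v2,v3,v4}"
    using octagon_from_within_distance4[OF c] by blast
  have b4: "b = v4"
    using ear3_ends[OF o out[unfolded s] adj(1,2)] b adj(3) by auto
  have xy: "x \<notin> set [v4,v3,v2,v1,a,v7,v6,v5]" "y \<notin> set [v4,v3,v2,v1,a,v7,v6,v5]"
    "x \<notin> set [v4,v5,v6,v7,a,v1,v2,v3]" "y \<notin> set [v4,v5,v6,v7,a,v1,v2,v3]"
    "x \<notin> set [a,v7,v6,v5,v4,v3,v2,v1]" "y \<notin> set [a,v7,v6,v5,v4,v3,v2,v1]"
    "x \<notin> set [a,v1,v2,v3,v4,v5,v6,v7]" "y \<notin> set [a,v1,v2,v3,v4,v5,v6,v7]"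
    using out s by auto
  have o': "octagon [v4,v3,v2,v1,a,v7,v6,v5]" "octagon [a,v7,v6,v5,v4,v3,v2,v1]"
    "octagon [v4,v5,v6,v7,a,v1,v2,v3]"
    using o by (auto simp: octagon_def adj_commute)
  have e: "adj a x" "adj x y" "adj y v4" "adj v4 y" "adj y x" "adj x a"
    using adj b4 adj_commute by metis+
  note d1 = theta344_degree_two[OF o xy(7,8) e(1-3)]
  note d2 = theta344_degree_two[OF o'(1) xy(2,1) e(4-6)]
  note d4 = theta344_degree_two[OF o'(3) xy(4,3) e(4-6)]
  note d3 = theta344_degree_two[OF o'(2) xy(5,6) e(1-3)]
  have d: "distinct [a,v1,v2,v3,v4,v5,v6,v7]" and av: "adj a v1" "adj v1 v2"
    using o by (simp_all add: octagon_def)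
  have "\<not> adj v2 a" using d1(2)[of a] d by auto
  moreover have "adj v2 v1" "v2 \<noteq> a" using av d adj_commute by auto
  ultimately obtain p where p: "distinct p" "successively adj p" "length p = 9" "hd p = v2" "last p = a"
    using saturated[of v2 v1 a v1] av by blast
  then obtain p1 p2 p3 p4 p5 p6 p7 where p': "p = [v2,p1,p2,p3,p4,p5,p6,p7,a]"
    by (auto simp: eval_nat_numeral length_Suc_conv)
  have pd: "distinct [v2,p1,p2,p3,p4,p5,p6,p7,a]"
    and ps: "adj v2 p1" "adj p1 p2" "adj p2 p3" "adj p3 p4" "adj p4 p5" "adj p5 p6" "adj p6 p7"
    using p unfolding p' by simp_all
  have sp: "adj u w \<Longrightarrow> adj w u" for u w by (simp add: adj_commute)
  have p12: "p1 = v3" "p2 = v4"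
    using d1(2)[OF ps(1)] d1(1)[of p2] d2(1)[of p2] ps(2) pd by auto
  \<comment> \<open>The side through \<open>v5\<close> has no exit and would end the path after six edges.\<close>
  have "p3 \<noteq> v5"
  proof
    assume "p3 = v5"
    then have "p4 = v6" using d4(1)[of p4] p12 ps pd by auto
    then have "p5 = v7" using d3(2)[of p5] \<open>p3 = v5\<close> ps pd by auto
    then show False using d3(1)[of p6] \<open>p4 = v6\<close> ps pd by auto
  qed
  then have p3: "p3 \<notin> set c"
    using d1(1)[of v4] d3(1)[of v4] d3(2)[of v4] sp[OF ps(3)] p12 pd d s by auto
  \<comment> \<open>The inner vertices of the two long sides have no neighbours outside the 8-cycle.\<close>
  have inside: "u \<in> set c" if "adj u w" "w \<in> set c" "w \<notin> {v2,v3,v4,a}" for u w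
    using d1(1)[of u] d4(1)[of u] d3(1)[of u] d3(2)[of u] sp[OF that(1)] that(2,3) s by auto
  have p4: "p4 \<notin> set c" using inside[OF ps(4)] p3 p12 pd by auto
  have p5: "p5 \<notin> set c" using inside[OF ps(5)] p4 p12 pd by auto
  have p6: "p6 \<notin> set c" using inside[OF ps(6)] p5 p12 pd by auto
  show False
    using outside_depth[OF c(1), of v4 p3 p4 p5 p6] p12 p3 p4 p5 p6 ps pd s by auto
qed

section \<open>No ear with four edges\<close>

text \<open>
  A further outside neighbour of \<open>x\<close> would be the fourth outside vertex on the way in from
  \<open>v1\<close> through \<open>z\<close> and \<open>y\<close>.
\<close>

lemma theta147_degree_two:
  assumes "octagon [v0,v1,v2,v3,v4,v5,v6,v7]"
    "{x,y,z} \<inter> set [v0,v1,v2,v3,v4,v5,v6,v7] = {}" "distinct [x,y,z]"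
    "adj v0 x" "adj x y" "adj y z" "adj z v1"
  shows "adj x w \<Longrightarrow> w = v0 \<or> w = y"
proof -
  note facts = assms[unfolded octagon_def] adj_commute
  have "\<not> adj x v1"
    using no_cycle9[of "[v0,v7,v6,v5,v4,v3,v2,v1,x]"] facts by auto
  moreover have "\<not> adj x v2"
    using unique_path[of "[v0,v1,z,y,x,v2,v3,v4,v5]" "[v0,x,y,z,v1,v2,v3,v4,v5]"] facts by auto
  moreover have "\<not> adj x v3"
    using no_cycle10[of "[v0,v1,z,y,x,v3,v4,v5,v6,v7]"] facts by auto
  moreover have "\<not> adj x v4"
    using no_cycle9[of "[v0,v1,z,y,x,v4,v5,v6,v7]"] facts by auto
  moreover have "\<not> adj x v5"
    using unique_path[of "[v0,v1,v2,v3,v4,v5,x,y,z]" "[v0,v7,v6,v5,v4,v3,v2,v1,z]"] facts by auto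
  moreover have "\<not> adj x v6"
    using no_cycle9[of "[v1,v2,v3,v4,v5,v6,x,y,z]"] facts by auto
  moreover have "\<not> adj x v7"
    using no_cycle9[of "[v0,v1,v2,v3,v4,v5,v6,v7,x]"] facts by auto
  moreover have "\<not> adj x z"
    using no_cycle10[of "[v0,v7,v6,v5,v4,v3,v2,v1,z,x]"] facts by auto
  moreover have "adj x w \<Longrightarrow> w \<in> {x,y,z} \<union> set [v0,v1,v2,v3,v4,v5,v6,v7]"
    using outside_depth[OF assms(1), of v1 z y x w] facts by auto
  ultimately show "adj x w \<Longrightarrow> w = v0 \<or> w = y" by auto
qed

text \<open>
  Let \<open>w\<close> be a further outside neighbour of the middle vertex \<open>y\<close>.  A neighbour \<open>u\<close> of \<open>w\<close> on the
  8-cycle would make \<open>w\<close> a duplicate of \<open>x\<close> or of \<open>z\<close>, or would complete a four-edge ear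
  whose ends are too far apart.
\<close>

lemma theta147_no_long_detour:
  assumes "octagon [v0,v1,v2,v3,v4,v5,v6,v7]"
    "{x,y,z} \<inter> set [v0,v1,v2,v3,v4,v5,v6,v7] = {}" "distinct [x,y,z]"
    "adj v0 x" "adj x y" "adj y z" "adj z v1"
    "adj y w" "w \<notin> {x,y,z} \<union> set [v0,v1,v2,v3,v4,v5,v6,v7]"
  shows "u \<in> set [v0,v1,v2,v3,v4,v5,v6,v7] \<Longrightarrow> \<not> adj w u"
proof -
  note facts = assms[unfolded octagon_def] adj_commute
  have "\<not> adj w v0"
    using unique_path[of "[v0,x,y,z,v1,v2,v3,v4,v5]" "[v0,w,y,z,v1,v2,v3,v4,v5]"] facts by auto
  moreover have "\<not> adj w v1"
    using unique_path[of "[v0,x,y,z,v1,v2,v3,v4,v5]" "[v0,x,y,w,v1,v2,v3,v4,v5]"] facts by auto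
  moreover have "\<not> adj w v2"
    using no_cycle10[of "[v0,v7,v6,v5,v4,v3,v2,w,y,x]"] facts by auto
  moreover have "\<not> adj w v3"
    using no_cycle9[of "[v0,v7,v6,v5,v4,v3,w,y,x]"] facts by auto
  moreover have "\<not> adj w v4"
    using no_cycle9[of "[v0,v1,z,y,w,v4,v5,v6,v7]"] facts by auto
  moreover have "\<not> adj w v5"
    using no_cycle9[of "[v0,v1,v2,v3,v4,v5,w,y,x]"] facts by auto
  moreover have "\<not> adj w v6"
    using no_cycle9[of "[v1,v2,v3,v4,v5,v6,w,y,z]"] facts by auto
  moreover have "\<not> adj w v7"
    using no_cycle10[of "[v1,v2,v3,v4,v5,v6,v7,w,y,z]"] facts by auto
  ultimately show "u \<in> set [v0,v1,v2,v3,v4,v5,v6,v7] \<Longrightarrow> \<not> adj w u" by auto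
qed

text \<open>
  Only an ear between consecutive vertices is left.  Its vertices \<open>x\<close> and \<open>z\<close> have degree two, and
  apart from them its middle vertex \<open>y\<close> has only neighbours of degree one.  So an eight-edge path
  from \<open>x\<close> to \<open>z\<close> misses \<open>y\<close>, and together with \<open>y\<close> it is a 10-cycle.
\<close>

lemma no_ear4:
  assumes c: "octagon c" "a \<in> set c" "b \<in> set c" "a \<noteq> b"
    and out: "{x,y,z} \<inter> set c = {}" "distinct [x,y,z]"
    and adj: "adj a x" "adj x y" "adj y z" "adj z b"
  shows False
proof -
  obtain v1 v2 v3 v4 v5 v6 v7 where o: "octagon [a,v1,v2,v3,v4,v5,v6,v7]"
    and s: "set c = set [a,v1,v2,v3,v4,v5,v6,v7]" and b: "b \<in> {v1,v2,v3,v4}"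
    using octagon_from_within_distance4[OF c] by blast
  have sp: "adj u w \<Longrightarrow> adj w u" for u w by (simp add: adj_commute)
  have b1: "b = v1"
    using ear4_ends[OF o out(2) out(1)[unfolded s] adj(1-3)] b adj(4) by auto
  have o': "octagon [v1,a,v7,v6,v5,v4,v3,v2]"
    using o by (auto simp: octagon_def adj_commute)
  have out': "{z,y,x} \<inter> set [v1,a,v7,v6,v5,v4,v3,v2] = {}" "distinct [z,y,x]"
    using out s by auto
  note e = adj[unfolded b1]
  note dx = theta147_degree_two[OF o out(1)[unfolded s] out(2) e]
  note dz = theta147_degree_two[OF o' out' sp[OF e(4)] sp[OF e(3)] sp[OF e(2)] sp[OF e(1)]]
  \<comment> \<open>Every neighbour of \<open>y\<close> other than \<open>x\<close> and \<open>z\<close> is a leaf.\<close>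
  have leaf: "u = y" if w: "adj y w" "w \<noteq> x" "w \<noteq> z" "adj w u" for w u
  proof (rule ccontr)
    assume u: "u \<noteq> y"
    have wy: "w \<noteq> y" using w by auto
    have wc: "w \<notin> set c"
    proof
      assume "w \<in> set c"
      then show False
        using no_ear3[OF c(1), of a w x y] no_ear3[OF c(1), of v1 w z y] e sp c w b1 out by auto
    qed
    have w_out: "w \<notin> {x,y,z} \<union> set [a,v1,v2,v3,v4,v5,v6,v7]" using wc s w wy by auto
    have "u \<notin> set c"
      using theta147_no_long_detour[OF o out(1)[unfolded s] out(2) e w(1) w_out, of u] w s by auto
    moreover have "u \<noteq> x" "u \<noteq> z" "u \<noteq> w"
      using dx[of w] dz[of w] w sp wy wc c b1 by auto
    ultimately show False
      using outside_depth[OF c(1,2), of x y w u] e w wy wc u out c by auto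
  qed
  have "\<not> adj x z" using dx[of z] out c by auto
  then obtain p where p: "distinct p" "successively adj p" "length p = 9" "hd p = x" "last p = z"
    using saturated[of x y z y] e sp out by auto
  then obtain p1 p2 p3 p4 p5 p6 p7 where p': "p = [x,p1,p2,p3,p4,p5,p6,p7,z]"
    by (auto simp: eval_nat_numeral length_Suc_conv)
  have pd: "distinct [x,p1,p2,p3,p4,p5,p6,p7,z]"
    and ps: "adj x p1" "adj p1 p2" "adj p2 p3" "adj p3 p4" "adj p4 p5" "adj p5 p6" "adj p6 p7" "adj p7 z"
    using p unfolding p' by simp_all
  have "y \<noteq> p1" using leaf[of p2 p3] ps pd by auto
  moreover have "y \<noteq> p2" using leaf[of p3 p4] ps pd by auto
  moreover have "y \<noteq> p3" using leaf[of p4 p5] ps pd by auto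
  moreover have "y \<noteq> p4" using leaf[of p5 p6] ps pd by auto
  moreover have "y \<noteq> p5" using leaf[of p6 p7] ps pd by auto
  moreover have "y \<noteq> p6" using leaf[of p7 z] ps pd by auto
  moreover have "y \<noteq> p7" using leaf[of p6 p5] sp ps pd by auto
  ultimately show False
    using no_cycle10[of "[x,p1,p2,p3,p4,p5,p6,p7,z,y]"] ps pd out e sp by auto
qed

section \<open>Eight-edge paths between vertices of an 8-cycle\<close>

text \<open>
  With three-edge and four-edge ears excluded, a path that stays outside for two steps is
  doomed to stay there for four, against \<open>outside_depth\<close>.
\<close>

lemma outside_excursion_returns:
  assumes c: "octagon c" "a \<in> set c" and x: "x \<notin> set c"
    and p: "distinct [a,x,y,z,w]" "successively adj [a,x,y,z,w]"
  shows "y \<in> set c"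
proof (rule ccontr)
  assume y: "y \<notin> set c"
  then have z: "z \<notin> set c" using no_ear3[OF c, of z x y] x p by auto
  then have "w \<notin> set c" using no_ear4[OF c, of w x y z] x y p by auto
  then show False using outside_depth[OF c p] x y z by auto
qed

text \<open>
  This reduces the visits of an eight-edge path to the outside to two-edge ears.  Away from the
  far end the previous lemma applies to five consecutive vertices; near it, a three-edge ear
  would appear.
\<close>

lemma path_alternates_outside:
  assumes c: "octagon c" and p: "distinct [p0,p1,p2,p3,p4,p5,p6,p7,p8]"
    "successively adj [p0,p1,p2,p3,p4,p5,p6,p7,p8]" and ends: "p0 \<in> set c" "p8 \<in> set c"
    and i: "x \<in> set [p1,p2,p3,p4,p5,p6,p7]" "x \<notin> set c"
  shows "\<exists>a b. a \<in> set c \<and> b \<in> set c \<and> a \<noteq> b \<and> adj a x \<and> adj x b"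
proof -
  note r = outside_excursion_returns[OF c]
  have 1: "p1 \<in> set c \<or> p2 \<in> set c" using r[of p0 p1 p2 p3 p4] p ends by auto
  have 2: "p2 \<in> set c \<or> p3 \<in> set c" using r[of p1 p2 p3 p4 p5] p 1 by auto
  have 3: "p3 \<in> set c \<or> p4 \<in> set c" using r[of p2 p3 p4 p5 p6] p 2 by auto
  have 4: "p4 \<in> set c \<or> p5 \<in> set c" using r[of p3 p4 p5 p6 p7] p 3 by auto
  have 5: "p5 \<in> set c \<or> p6 \<in> set c" using r[of p4 p5 p6 p7 p8] p 4 by auto
  have 6: "p6 \<in> set c \<or> p7 \<in> set c" using no_ear3[OF c, of p5 p8 p6 p7] p 5 ends by auto
  have s: "adj p0 p1" "adj p1 p2" "adj p2 p3" "adj p3 p4" "adj p4 p5" "adj p5 p6" "adj p6 p7" "adj p7 p8"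
    using p(2) by simp_all
  have d: "p0 \<noteq> p2" "p1 \<noteq> p3" "p2 \<noteq> p4" "p3 \<noteq> p5" "p4 \<noteq> p6" "p5 \<noteq> p7" "p6 \<noteq> p8" using p(1) by auto
  from i(1) consider "x = p1" | "x = p2" | "x = p3" | "x = p4" | "x = p5" | "x = p6" | "x = p7" by auto
  then show ?thesis
    by cases (use i(2) 1 2 3 4 5 6 ends d s in blast)+
qed

text \<open>
  If \<open>w\<close> came later on the path, both its neighbours there would differ from \<open>a\<close>, although
  only \<open>b\<close> is available.  Two such vertices \<open>w\<close> for the same start \<open>a\<close> are contradictory, which
  is how Hamiltonian paths are excluded below.
\<close>

lemma second_vertex_if_degree_two:
  assumes p: "distinct (a # ys)" "successively adj (a # ys)" "set (a # ys) \<subseteq> S"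
    and w: "w \<in> set ys" "w \<noteq> last ys"
    and deg: "\<And>q. adj w q \<Longrightarrow> q \<in> S \<Longrightarrow> q = a \<or> q = b"
  shows "w = hd ys"
proof -
  obtain us vs where ys: "ys = us @ w # vs" using w(1) by (meson split_list)
  show ?thesis
  proof (cases "us = []")
    case True
    then show ?thesis using ys by simp
  next
    case False
    have "vs \<noteq> []" using ys w(2) by auto
    then have "adj (last us) w" "adj w (hd vs)"
      using p(2) False unfolding ys by (auto simp: successively_append_iff successively_Cons)
    moreover have l: "last us \<in> set us" "hd vs \<in> set vs" using False \<open>vs \<noteq> []\<close> by auto
    then have "last us \<in> S" "hd vs \<in> S" "last us \<noteq> a" "hd vs \<noteq> a" "last us \<noteq> hd vs"
      using p(1,3) ys by auto
    ultimately show ?thesis using deg[of "last us"] deg[of "hd vs"] adj_commute by metis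
  qed
qed

lemma ear2_opposite:
  assumes "octagon [v0,v1,v2,v3,v4,v5,v6,v7]" "x \<notin> set [v0,v1,v2,v3,v4,v5,v6,v7]"
    "adj v0 x" "adj x b" "b \<in> set [v0,v1,v2,v3,v4,v5,v6,v7]" "b \<noteq> v0"
  shows "b \<in> {v3,v4,v5}"
  using ear2_ends[OF assms(1-3)] assms(4-6) by auto

text \<open>
  The twelve pairs of vertices at distance 3 or 4 on the 8-cycle, written out for comparison
  with the explicit clashes of the next two sections.
\<close>

lemma ear2_opposite_pairs:
  assumes o: "octagon [v0,v1,v2,v3,v4,v5,v6,v7]" and x: "x \<notin> set [v0,v1,v2,v3,v4,v5,v6,v7]"
    and ab: "a \<in> set [v0,v1,v2,v3,v4,v5,v6,v7]" "b \<in> set [v0,v1,v2,v3,v4,v5,v6,v7]" "a \<noteq> b"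
      "adj a x" "adj x b"
  shows "adj x v0 \<and> adj x v3 \<or> adj x v1 \<and> adj x v4 \<or> adj x v2 \<and> adj x v5 \<or> adj x v3 \<and> adj x v6 \<or>
    adj x v4 \<and> adj x v7 \<or> adj x v5 \<and> adj x v0 \<or> adj x v6 \<and> adj x v1 \<or> adj x v7 \<and> adj x v2 \<or>
    adj x v0 \<and> adj x v4 \<or> adj x v1 \<and> adj x v5 \<or> adj x v2 \<and> adj x v6 \<or> adj x v3 \<and> adj x v7"
proof -
  have r: "octagon [v1,v2,v3,v4,v5,v6,v7,v0]" "octagon [v2,v3,v4,v5,v6,v7,v0,v1]"
    "octagon [v3,v4,v5,v6,v7,v0,v1,v2]" "octagon [v4,v5,v6,v7,v0,v1,v2,v3]"
    "octagon [v5,v6,v7,v0,v1,v2,v3,v4]" "octagon [v6,v7,v0,v1,v2,v3,v4,v5]"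
    "octagon [v7,v0,v1,v2,v3,v4,v5,v6]"
    using o by (auto simp: octagon_def adj_commute)
  note opp = ear2_opposite[OF o, of x b] ear2_opposite[OF r(1), of x b] ear2_opposite[OF r(2), of x b]
    ear2_opposite[OF r(3), of x b] ear2_opposite[OF r(4), of x b] ear2_opposite[OF r(5), of x b]
    ear2_opposite[OF r(6), of x b] ear2_opposite[OF r(7), of x b]
  have xa: "adj x a" using ab(4) adj_commute by simp
  from ab(1) consider "a = v0" | "a = v1" | "a = v2" | "a = v3" | "a = v4" | "a = v5" | "a = v6" | "a = v7"
    by auto
  then show ?thesis
  proof cases
    case 1
    then have "b \<in> {v3,v4,v5}" using opp(1) x ab by (simp; blast)
    then show ?thesis using xa ab(5) 1 by blast
  next
    case 2
    then have "b \<in> {v4,v5,v6}" using opp(2) x ab by (simp; blast)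
    then show ?thesis using xa ab(5) 2 by blast
  next
    case 3
    then have "b \<in> {v5,v6,v7}" using opp(3) x ab by (simp; blast)
    then show ?thesis using xa ab(5) 3 by blast
  next
    case 4
    then have "b \<in> {v6,v7,v0}" using opp(4) x ab by (simp; blast)
    then show ?thesis using xa ab(5) 4 by blast
  next
    case 5
    then have "b \<in> {v7,v0,v1}" using opp(5) x ab by (simp; blast)
    then show ?thesis using xa ab(5) 5 by blast
  next
    case 6
    then have "b \<in> {v0,v1,v2}" using opp(6) x ab by (simp; blast)
    then show ?thesis using xa ab(5) 6 by blast
  next
    case 7
    then have "b \<in> {v1,v2,v3}" using opp(7) x ab by (simp; blast)
    then show ?thesis using xa ab(5) 7 by blast
  next
    case 8
    then have "b \<in> {v2,v3,v4}" using opp(8) x ab by (simp; blast)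
    then show ?thesis using xa ab(5) 8 by blast
  qed
qed

section \<open>No two-edge ear between antipodal vertices\<close>

text \<open>
  Up to the four symmetries of the theta graph with sides of 2, 4 and 4 edges, these are the
  pairs whose adjacency would matter on a Hamiltonian path and is impossible.
\<close>

lemma theta244_nonchords:
  assumes "octagon [v0,v1,v2,v3,v4,v5,v6,v7]" "x \<notin> set [v0,v1,v2,v3,v4,v5,v6,v7]"
    "adj v0 x" "adj x v4"
  shows "\<not> adj v0 v3" "\<not> adj v1 v3" "\<not> adj v1 v5" "\<not> adj v1 v6"
    "\<not> adj x v1" "\<not> adj x v2"
proof -
  note facts = assms[unfolded octagon_def] adj_commute
  show "\<not> adj v0 v3"
    using unique_path[of "[v1,v2,v3,v0,v7,v6,v5,v4,x]" "[v1,v2,v3,v4,v5,v6,v7,v0,x]"] facts by auto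
  show "\<not> adj v1 v3"
    using unique_path[of "[v2,v1,v3,v4,v5,v6,v7,v0,x]" "[v2,v3,v1,v0,v7,v6,v5,v4,x]"] facts by auto
  show "\<not> adj v1 v5"
    using no_cycle9[of "[v0,v7,v6,v5,v1,v2,v3,v4,x]"] facts by auto
  show "\<not> adj v1 v6"
    using unique_path[of "[v3,v2,v1,v0,x,v4,v5,v6,v7]" "[v3,v2,v1,v6,v5,v4,x,v0,v7]"] facts by auto
  show "\<not> adj x v1"
    using no_cycle9[of "[v0,v7,v6,v5,v4,v3,v2,v1,x]"] facts by auto
  show "\<not> adj x v2"
    using unique_path[of "[v1,v0,v7,v6,v5,v4,v3,v2,x]" "[v1,v2,v3,v4,v5,v6,v7,v0,x]"] facts by auto
qed

text \<open>
  The chord \<open>{v1, v7}\<close>, which skips the hub \<open>v0\<close>, tolerates no other chord.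
\<close>

lemma theta244_long_chord:
  assumes "octagon [v0,v1,v2,v3,v4,v5,v6,v7]" "x \<notin> set [v0,v1,v2,v3,v4,v5,v6,v7]"
    "adj v0 x" "adj x v4" "adj v1 v7"
  shows "\<not> adj v0 v2" "\<not> adj v0 v4" "\<not> adj v2 v4" "\<not> adj v2 v6" "\<not> adj v3 v5"
proof -
  note facts = assms[unfolded octagon_def] adj_commute
  show "\<not> adj v0 v2"
    using unique_path[of "[v1,v2,v3,v4,v5,v6,v7,v0,x]" "[v1,v7,v6,v5,v4,v3,v2,v0,x]"] facts by auto
  show "\<not> adj v0 v4"
    using unique_path[of "[v3,v2,v1,v0,v7,v6,v5,v4,x]" "[v3,v2,v1,v7,v6,v5,v4,v0,x]"] facts by auto
  show "\<not> adj v2 v4"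
    using unique_path[of "[v3,v2,v1,v0,v7,v6,v5,v4,x]" "[v3,v2,v4,v5,v6,v7,v1,v0,x]"] facts by auto
  show "\<not> adj v2 v6"
    using unique_path[of "[v1,v2,v3,v4,x,v0,v7,v6,v5]" "[v1,v7,v0,x,v4,v3,v2,v6,v5]"] facts by auto
  show "\<not> adj v3 v5"
    using unique_path[of "[v2,v1,v0,v7,v6,v5,v3,v4,x]" "[v2,v3,v4,v5,v6,v7,v1,v0,x]"] facts by auto
qed

text \<open>
  Up to symmetry, these are the ways to attach a second two-edge ear at distance 3 or 4.
\<close>

lemma theta244_second_ear:
  assumes "octagon [v0,v1,v2,v3,v4,v5,v6,v7]" "x \<notin> set [v0,v1,v2,v3,v4,v5,v6,v7]"
    "adj v0 x" "adj x v4"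
    "w \<notin> insert x (set [v0,v1,v2,v3,v4,v5,v6,v7])"
  shows "adj w v0 \<Longrightarrow> \<not> adj w v4" "adj w v1 \<Longrightarrow> \<not> adj w v5"
    "adj w v2 \<Longrightarrow> \<not> adj w v6" "adj w v0 \<Longrightarrow> \<not> adj w v3"
    "adj w v1 \<Longrightarrow> \<not> adj w v6"
proof -
  note facts = assms[unfolded octagon_def] adj_commute
  show "adj w v0 \<Longrightarrow> \<not> adj w v4"
    using unique_path[of "[v1,v2,v3,v4,x,v0,v7,v6,v5]" "[v1,v2,v3,v4,w,v0,v7,v6,v5]"] facts by auto
  show "adj w v1 \<Longrightarrow> \<not> adj w v5"
    using no_cycle10[of "[v0,v7,v6,v5,w,v1,v2,v3,v4,x]"] facts by auto
  show "adj w v2 \<Longrightarrow> \<not> adj w v6"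
    using unique_path[of "[v1,v0,v7,v6,w,v2,v3,v4,v5]" "[v1,v0,x,v4,v3,v2,w,v6,v5]"] facts by auto
  show "adj w v0 \<Longrightarrow> \<not> adj w v3"
    using unique_path[of "[v2,v1,v0,w,v3,v4,v5,v6,v7]" "[v2,v3,w,v0,x,v4,v5,v6,v7]"] facts by auto
  show "adj w v1 \<Longrightarrow> \<not> adj w v6"
    using no_cycle9[of "[v0,v7,v6,w,v1,v2,v3,v4,x]"] facts by auto
qed

text \<open>
  An eight-edge path from \<open>v1\<close> to \<open>v3\<close> never leaves the nine vertices of the theta graph, hence it
  visits all of them.  Without the chords \<open>{v1, v7}\<close> and \<open>{v3, v5}\<close>, a path starting with
  \<open>v0\<close> would have to continue with both \<open>x\<close> and \<open>v7\<close>, a path ending with \<open>v4\<close> would have to come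
  from both \<open>x\<close> and \<open>v5\<close>, and \<open>v2\<close> cannot be both the second and the last but one vertex.
  The chord \<open>{v1, v7}\<close> excludes all other chords; the path must then come to \<open>v3\<close> from \<open>v2\<close>, which
  has no further neighbour.  The chord \<open>{v3, v5}\<close> is its mirror image.
\<close>

lemma no_ear2_antipodal:
  assumes o: "octagon [v0,v1,v2,v3,v4,v5,v6,v7]" and x: "x \<notin> set [v0,v1,v2,v3,v4,v5,v6,v7]"
    and e: "adj v0 x" "adj x v4"
  shows False
proof -
  let ?C = "set [v0,v1,v2,v3,v4,v5,v6,v7]"
  have sp: "adj u w \<Longrightarrow> adj w u" for u w by (simp add: adj_commute)
  have o': "octagon [v0,v7,v6,v5,v4,v3,v2,v1]" "octagon [v4,v3,v2,v1,v0,v7,v6,v5]"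
    "octagon [v4,v5,v6,v7,v0,v1,v2,v3]"
    using o by (auto simp: octagon_def adj_commute)
  have x': "x \<notin> set [v0,v7,v6,v5,v4,v3,v2,v1]" "x \<notin> set [v4,v3,v2,v1,v0,v7,v6,v5]"
    "x \<notin> set [v4,v5,v6,v7,v0,v1,v2,v3]"
    using x by auto
  note sym = sp[OF e(2)] sp[OF e(1)]
  note nonadj = theta244_nonchords[OF o x e] theta244_nonchords[OF o'(1) x'(1) e]
    theta244_nonchords[OF o'(2) x'(2) sym] theta244_nonchords[OF o'(3) x'(3) sym]
  have no_second_ear: False
    if w: "w \<notin> insert x ?C" and ab: "a \<in> ?C" "b \<in> ?C" "a \<noteq> b" "adj a w" "adj w b" for w a b
  proof -
    have w': "w \<notin> insert x (set [v0,v7,v6,v5,v4,v3,v2,v1])" "w \<notin> insert x (set [v4,v3,v2,v1,v0,v7,v6,v5])"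
      "w \<notin> insert x (set [v4,v5,v6,v7,v0,v1,v2,v3])"
      using w by auto
    note far = theta244_second_ear[OF o x e w] theta244_second_ear[OF o'(1) x'(1) e w'(1)]
      theta244_second_ear[OF o'(2) x'(2) sym w'(2)]
      theta244_second_ear[OF o'(3) x'(3) sym w'(3)]
    have wC: "w \<notin> ?C" using w by simp
    show False
      using ear2_opposite_pairs[OF o wC ab] far by blast
  qed
  have d: "distinct [v0,v1,v2,v3,v4,v5,v6,v7]" and cyc: "adj v0 v1" "adj v1 v2" "adj v2 v3" "adj v3 v4"
    using o by (simp_all add: octagon_def)
  have "\<not> adj v1 v3" "v1 \<noteq> v3" using nonadj(2) d by auto
  then obtain p where p: "distinct p" "successively adj p" "length p = 9" "hd p = v1" "last p = v3"
    using saturated[of v1 v2 v3 v4] cyc by auto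
  then obtain p1 p2 p3 p4 p5 p6 p7 where p': "p = [v1,p1,p2,p3,p4,p5,p6,p7,v3]"
    by (auto simp: eval_nat_numeral length_Suc_conv)
  have pd: "distinct [v1,p1,p2,p3,p4,p5,p6,p7,v3]" and ps: "successively adj [v1,p1,p2,p3,p4,p5,p6,p7,v3]"
    using p unfolding p' by simp_all
  have "set [p1,p2,p3,p4,p5,p6,p7] \<subseteq> insert x ?C"
  proof
    fix w assume "w \<in> set [p1,p2,p3,p4,p5,p6,p7]"
    then show "w \<in> insert x ?C"
      using path_alternates_outside[OF o pd ps, of w] no_second_ear[of w] by auto
  qed
  then have H: "p1 \<in> insert x ?C" "p2 \<in> insert x ?C" "p3 \<in> insert x ?C" "p4 \<in> insert x ?C"
    "p5 \<in> insert x ?C" "p6 \<in> insert x ?C" "p7 \<in> insert x ?C" by auto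
  have "set p = insert x ?C"
  proof (rule card_subset_eq)
    show "set p \<subseteq> insert x ?C" using H unfolding p' by auto
    have "card (set p) = 9" using p(1,3) distinct_card by metis
    moreover have "card (insert x ?C) = 9" using d x by (simp add: card_insert_if)
    ultimately show "card (set p) = card (insert x ?C)" by simp
  qed simp
  then have inner: "w \<in> set [p1,p2,p3,p4,p5,p6,p7]" if "w \<in> insert x ?C" "w \<noteq> v1" "w \<noteq> v3" for w
    using that unfolding p' by auto
  have on_path: "set [p1,p2,p3,p4,p5,p6,p7,v3] \<subseteq> insert x ?C" "set [p7,p6,p5,p4,p3,p2,p1,v1] \<subseteq> insert x ?C"
    using H by auto
  have nx: "q = v0 \<or> q = v4" if "adj x q" "q \<in> insert x ?C" for q
    using nonadj that by (auto simp: adj_commute)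
  have n1: "q = v0 \<or> q = v2 \<or> q = v7" if "adj v1 q" "q \<in> insert x ?C" for q
    using nonadj that by (auto simp: adj_commute)
  have n2: "q = v1 \<or> q = v3 \<or> q = v0 \<or> q = v4 \<or> q = v6" if "adj v2 q" "q \<in> insert x ?C" for q
    using nonadj that by (auto simp: adj_commute)
  have n3: "q = v2 \<or> q = v4 \<or> q = v5" if "adj v3 q" "q \<in> insert x ?C" for q
    using nonadj that by (auto simp: adj_commute)
  have n5: "q = v4 \<or> q = v6 \<or> q = v3" if "adj v5 q" "q \<in> insert x ?C" for q
    using nonadj that by (auto simp: adj_commute)
  have n7: "q = v0 \<or> q = v6 \<or> q = v1" if "adj v7 q" "q \<in> insert x ?C" for q
    using nonadj that by (auto simp: adj_commute)
  have n7': "q = v0 \<or> q = v6" if "\<not> adj v1 v7" "adj v7 q" "q \<in> insert x ?C" for q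
    using n7[OF that(2,3)] that sp by blast
  have n5': "q = v4 \<or> q = v6" if "\<not> adj v3 v5" "adj v5 q" "q \<in> insert x ?C" for q
    using n5[OF that(2,3)] that sp by blast
  have rev: "distinct [v3,p7,p6,p5,p4,p3,p2,p1,v1]" "successively adj [v3,p7,p6,p5,p4,p3,p2,p1,v1]"
    using pd ps by (auto intro: sp)
  have step: "adj v1 p1" "adj p1 p2" "adj v3 p7" "adj p7 p6" using ps by (auto intro: sp)
  \<comment> \<open>Otherwise both \<open>x\<close> and \<open>v7\<close> would have to follow \<open>v0\<close>.\<close>
  have p1_not_v0: "p1 \<noteq> v0" if "\<not> adj v1 v7"
  proof
    assume p1: "p1 = v0"
    have path: "distinct (v0 # [p2,p3,p4,p5,p6,p7,v3])" "successively adj (v0 # [p2,p3,p4,p5,p6,p7,v3])"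
      "set (v0 # [p2,p3,p4,p5,p6,p7,v3]) \<subseteq> insert x ?C"
      using pd ps p1 on_path by auto
    have "x \<in> set [p2,p3,p4,p5,p6,p7,v3]" "x \<noteq> last [p2,p3,p4,p5,p6,p7,v3]"
      using inner[of x] p1 x by auto
    from second_vertex_if_degree_two[OF path this nx] have "x = p2" by simp
    moreover have "v7 \<in> set [p2,p3,p4,p5,p6,p7,v3]" "v7 \<noteq> last [p2,p3,p4,p5,p6,p7,v3]"
      using inner[of v7] p1 d by auto
    from second_vertex_if_degree_two[OF path this n7'[OF that]] have "v7 = p2" by simp
    ultimately show False using x by auto
  qed
  \<comment> \<open>Otherwise both \<open>x\<close> and \<open>v5\<close> would have to precede \<open>v4\<close>.\<close>
  have p7_not_v4: "p7 \<noteq> v4" if "\<not> adj v3 v5"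
  proof
    assume p7: "p7 = v4"
    have path: "distinct (v4 # [p6,p5,p4,p3,p2,p1,v1])" "successively adj (v4 # [p6,p5,p4,p3,p2,p1,v1])"
      "set (v4 # [p6,p5,p4,p3,p2,p1,v1]) \<subseteq> insert x ?C"
      using rev p7 on_path by auto
    have "x \<in> set [p6,p5,p4,p3,p2,p1,v1]" "x \<noteq> last [p6,p5,p4,p3,p2,p1,v1]"
      using inner[of x] p7 x by auto
    from second_vertex_if_degree_two[OF path this, of v0] nx have "x = p6" by (metis list.sel(1))
    moreover have "v5 \<in> set [p6,p5,p4,p3,p2,p1,v1]" "v5 \<noteq> last [p6,p5,p4,p3,p2,p1,v1]"
      using inner[of v5] p7 d by auto
    from second_vertex_if_degree_two[OF path this n5'[OF that]] have "v5 = p6" by simp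
    ultimately show False using x by auto
  qed
  show False
  proof (cases "adj v1 v7")
    case True
    note no = theta244_long_chord[OF o x e True] theta244_long_chord[OF o'(1) x'(1) e sp[OF True]]
    have "p7 = v2" using n3[of p7] step(3) p7_not_v4 no on_path by auto
    then have "p6 = v1 \<or> p6 = v3" using n2[of p6] step(4) no on_path by (auto simp: adj_commute[of v2])
    then show False using pd by auto
  next
    case no17: False
    show False
    proof (cases "adj v3 v5")
      case True
      note no = theta244_long_chord[OF o'(2) x'(2) sym True] theta244_long_chord[OF o'(3) x'(3) sym sp[OF True]]
      have "p1 = v2" using n1[of p1] step(1) p1_not_v0 no17 on_path by auto
      then have "p2 = v1 \<or> p2 = v3" using n2[of p2] step(2) no on_path by (auto simp: adj_commute[of v2])
      then show False using pd by auto
    next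
      case False
      have "p1 = v2" using n1[of p1] step(1) p1_not_v0 no17 on_path by auto
      moreover have "p7 = v2" using n3[of p7] step(3) p7_not_v4 False on_path by auto
      ultimately show False using pd by auto
    qed
  qed
qed

section \<open>No two-edge ear between vertices at distance three\<close>

text \<open>
  In the theta graph with sides of 2, 3 and 5 edges, \<open>v1\<close> has no chord at all, and \<open>v0\<close> and
  \<open>v2\<close> are a nonadjacent pair to which saturation applies.
\<close>

lemma theta235_nonchords:
  assumes "octagon [v0,v1,v2,v3,v4,v5,v6,v7]" "x \<notin> set [v0,v1,v2,v3,v4,v5,v6,v7]"
    "adj v0 x" "adj x v3"
  shows "\<not> adj v1 v3" "\<not> adj v1 v4" "\<not> adj v1 v5" "\<not> adj v1 v6"
    "\<not> adj v1 v7" "\<not> adj v0 v2"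
proof -
  note facts = assms[unfolded octagon_def] adj_commute
  show "\<not> adj v1 v3"
    using unique_path[of "[v2,v1,v0,v7,v6,v5,v4,v3,x]" "[v2,v1,v3,v4,v5,v6,v7,v0,x]"] facts by auto
  show "\<not> adj v1 v4"
    using no_cycle9[of "[v0,v7,v6,v5,v4,v1,v2,v3,x]"] facts by auto
  show "\<not> adj v1 v5"
    using unique_path[of "[v4,v3,v2,v1,v5,v6,v7,v0,x]" "[v4,v5,v6,v7,v0,v1,v2,v3,x]"] facts by auto
  show "\<not> adj v1 v6"
    using unique_path[of "[v2,v1,v0,x,v3,v4,v5,v6,v7]" "[v2,v1,v6,v5,v4,v3,x,v0,v7]"] facts by auto
  show "\<not> adj v1 v7"
    using unique_path[of "[v2,v1,v0,v7,v6,v5,v4,v3,x]" "[v2,v3,v4,v5,v6,v7,v1,v0,x]"] facts by auto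
  show "\<not> adj v0 v2"
    using unique_path[of "[v1,v2,v0,v7,v6,v5,v4,v3,x]" "[v1,v2,v3,v4,v5,v6,v7,v0,x]"] facts by auto
qed

text \<open>
  Up to the mirror symmetry that exchanges the hubs \<open>v0\<close> and \<open>v3\<close>, these are the ways to attach
  a second two-edge ear at distance 3.
\<close>

lemma theta235_second_ear:
  assumes "octagon [v0,v1,v2,v3,v4,v5,v6,v7]" "x \<notin> set [v0,v1,v2,v3,v4,v5,v6,v7]"
    "adj v0 x" "adj x v3"
    "w \<notin> insert x (set [v0,v1,v2,v3,v4,v5,v6,v7])"
  shows "adj w v0 \<Longrightarrow> \<not> adj w v3" "adj w v1 \<Longrightarrow> \<not> adj w v4"
    "adj w v2 \<Longrightarrow> \<not> adj w v5" "adj w v3 \<Longrightarrow> \<not> adj w v6"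
    "adj w v4 \<Longrightarrow> \<not> adj w v7"
proof -
  note facts = assms[unfolded octagon_def] adj_commute
  show "adj w v0 \<Longrightarrow> \<not> adj w v3"
    using unique_path[of "[v1,v2,v3,x,v0,v7,v6,v5,v4]" "[v1,v2,v3,w,v0,v7,v6,v5,v4]"] facts by auto
  show "adj w v1 \<Longrightarrow> \<not> adj w v4"
    using no_cycle10[of "[v0,v7,v6,v5,v4,w,v1,v2,v3,x]"] facts by auto
  show "adj w v2 \<Longrightarrow> \<not> adj w v5"
    using unique_path[of "[v1,v0,v7,v6,v5,w,v2,v3,x]" "[v1,v2,v3,v4,v5,v6,v7,v0,x]"] facts by auto
  show "adj w v3 \<Longrightarrow> \<not> adj w v6"
    using unique_path[of "[v2,v1,v0,v7,v6,v5,v4,v3,w]" "[v2,v1,v0,x,v3,v4,v5,v6,w]"] facts by auto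
  show "adj w v4 \<Longrightarrow> \<not> adj w v7"
    using unique_path[of "[v1,v0,x,v3,v4,w,v7,v6,v5]" "[v1,v2,v3,x,v0,v7,w,v4,v5]"] facts by auto
qed

text \<open>
  An eight-edge path from \<open>v0\<close> to \<open>v2\<close> again visits all nine vertices of the theta graph.  Among
  these, \<open>x\<close> and \<open>v1\<close> have degree two and are adjacent to the first vertex \<open>v0\<close>, so both would be
  the second vertex.
\<close>

lemma no_ear2_distance3:
  assumes o: "octagon [v0,v1,v2,v3,v4,v5,v6,v7]" and x: "x \<notin> set [v0,v1,v2,v3,v4,v5,v6,v7]"
    and e: "adj v0 x" "adj x v3"
  shows False
proof -
  let ?C = "set [v0,v1,v2,v3,v4,v5,v6,v7]"
  have sp: "adj u w \<Longrightarrow> adj w u" for u w by (simp add: adj_commute)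
  have o': "octagon [v3,v2,v1,v0,v7,v6,v5,v4]"
    using o by (auto simp: octagon_def adj_commute)
  have x': "x \<notin> set [v3,v2,v1,v0,v7,v6,v5,v4]" using x by auto
  have r: "octagon [v1,v2,v3,v4,v5,v6,v7,v0]" "octagon [v2,v3,v4,v5,v6,v7,v0,v1]"
    "octagon [v3,v4,v5,v6,v7,v0,v1,v2]"
    using o by (auto simp: octagon_def adj_commute)
  note sym = sp[OF e(2)] sp[OF e(1)]
  have no_second_ear: False
    if w: "w \<notin> insert x ?C" and ab: "a \<in> ?C" "b \<in> ?C" "a \<noteq> b" "adj a w" "adj w b" for w a b
  proof -
    have w': "w \<notin> insert x (set [v3,v2,v1,v0,v7,v6,v5,v4])" using w by auto
    note far = theta235_second_ear[OF o x e w] theta235_second_ear[OF o' x' sym w']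
    have wC: "w \<notin> ?C" using w by simp
    then have wr: "w \<notin> set [v1,v2,v3,v4,v5,v6,v7,v0]" "w \<notin> set [v2,v3,v4,v5,v6,v7,v0,v1]"
      "w \<notin> set [v3,v4,v5,v6,v7,v0,v1,v2]" by auto
    have anti: "adj w v0 \<Longrightarrow> \<not> adj w v4" "adj w v1 \<Longrightarrow> \<not> adj w v5" "adj w v2 \<Longrightarrow> \<not> adj w v6"
      "adj w v3 \<Longrightarrow> \<not> adj w v7"
      using no_ear2_antipodal[OF o wC] no_ear2_antipodal[OF r(1) wr(1)]
        no_ear2_antipodal[OF r(2) wr(2)] no_ear2_antipodal[OF r(3) wr(3)] sp by blast+
    show False using ear2_opposite_pairs[OF o wC ab] far anti by blast
  qed
  note nonadj = theta235_nonchords[OF o x e]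
  have d: "distinct [v0,v1,v2,v3,v4,v5,v6,v7]" and cyc: "adj v0 v1" "adj v1 v2"
    using o by (simp_all add: octagon_def)
  have "\<not> adj v0 v2" "v0 \<noteq> v2" using nonadj d by auto
  then obtain p where p: "distinct p" "successively adj p" "length p = 9" "hd p = v0" "last p = v2"
    using saturated[of v0 v1 v2 v1] cyc(1) sp[OF cyc(2)] by auto
  then obtain p1 p2 p3 p4 p5 p6 p7 where p': "p = [v0,p1,p2,p3,p4,p5,p6,p7,v2]"
    by (auto simp: eval_nat_numeral length_Suc_conv)
  have pd: "distinct [v0,p1,p2,p3,p4,p5,p6,p7,v2]" and ps: "successively adj [v0,p1,p2,p3,p4,p5,p6,p7,v2]"
    using p unfolding p' by simp_all
  have H: "set p \<subseteq> insert x ?C"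
  proof
    fix w assume "w \<in> set p"
    then show "w \<in> insert x ?C"
      using path_alternates_outside[OF o pd ps, of w] no_second_ear[of w] unfolding p' by auto
  qed
  have "set p = insert x ?C"
  proof (rule card_subset_eq)
    have "card (set p) = 9" using p(1,3) distinct_card by metis
    moreover have "card (insert x ?C) = 9" using d x by (simp add: card_insert_if)
    ultimately show "card (set p) = card (insert x ?C)" by simp
  qed (use H in simp_all)
  then have inner: "w \<in> set [p1,p2,p3,p4,p5,p6,p7,v2]" "w \<noteq> last [p1,p2,p3,p4,p5,p6,p7,v2]"
    if "w \<in> insert x ?C" "w \<noteq> v0" "w \<noteq> v2" for w
    using that unfolding p' by auto
  have n1: "q = v0 \<or> q = v2" if "adj v1 q" "q \<in> insert x ?C" for q
    using nonadj ear2_ends[OF o x e(1)] that by (auto simp: adj_commute)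
  have nx: "q = v0 \<or> q = v3" if "adj x q" "q \<in> insert x ?C" for q
    using ear2_opposite[OF o x e(1), of q] ear2_opposite[OF o' x' sym(1), of q] that d by auto
  have "set [v0,p1,p2,p3,p4,p5,p6,p7,v2] \<subseteq> insert x ?C" using H unfolding p' .
  note second = second_vertex_if_degree_two[OF pd ps this]
  have "x \<in> insert x ?C" "x \<noteq> v0" "x \<noteq> v2" using x by auto
  from second[OF inner[OF this] nx] have "x = p1" by simp
  moreover have "v1 \<in> insert x ?C" "v1 \<noteq> v0" "v1 \<noteq> v2" using d by auto
  from second[OF inner[OF this] n1] have "v1 = p1" by simp
  ultimately show False using x by simp
qed

section \<open>An 8-cycle has no ear\<close>

lemma no_short_ear2:
  assumes c: "octagon c" "a \<in> set c" "b \<in> set c" "a \<noteq> b" and x: "x \<notin> set c" "adj a x" "adj x b"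
  shows False
proof -
  obtain v1 v2 v3 v4 v5 v6 v7 where o: "octagon [a,v1,v2,v3,v4,v5,v6,v7]"
    and s: "set c = set [a,v1,v2,v3,v4,v5,v6,v7]" and b: "b \<in> {v1,v2,v3,v4}"
    using octagon_from_within_distance4[OF c] by blast
  note x' = x(1)[unfolded s]
  show False
    using b x(3) ear2_ends[OF o x' x(2)] no_ear2_distance3[OF o x' x(2)] no_ear2_antipodal[OF o x' x(2)]
    by auto
qed

text \<open>
  Ears with one, two and three inner vertices are excluded above, and four inner vertices
  already lie too deep.
\<close>

lemma no_ear:
  assumes c: "octagon c" "a \<in> set c" "b \<in> set c" "a \<noteq> b"
    and p: "distinct p" "p \<noteq> []" "set p \<inter> set c = {}" "successively adj (a # p @ [b])"
  shows False
proof -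
  consider x where "p = [x]" | x y where "p = [x,y]" | x y z where "p = [x,y,z]"
    | x y z w q where "p = x # y # z # w # q"
    using p(2) by (metis list.exhaust)
  then show False
  proof cases
    case 1 then show False using no_short_ear2[OF c, of x] p by auto
  next
    case 2 then show False using no_ear3[OF c, of x y] p by auto
  next
    case 3 then show False using no_ear4[OF c, of x y z] p by auto
  next
    case 4 
    then have "distinct [a,x,y,z,w]" using p c by auto
    with 4 show False using outside_depth[OF c(1,2), of x y z w] p by auto
  qed
qed

end

section \<open>From edge sets to paths\<close>

text \<open>
  Two paths that are closed to the same cycle by the same edge coincide.  Unique saturation counts
  cycles as edge sets; this turns it into uniqueness of paths.
\<close>

lemma cycle_edges_eq_imp_eq:
  assumes p: "distinct p" "length p = n" and q: "distinct q" "length q = n" and n: "n \<ge> 3"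
    and ends: "hd p = hd q" "last p = last q" and e: "cycle_edges p = cycle_edges q"
  shows "p = q"
proof -
  have ne: "p \<noteq> []" "q \<noteq> []" using p(2) q(2) n by auto
  have start: "p ! 0 = q ! 0" and stop: "p ! (n - 1) = q ! (n - 1)"
    using ends p(2) q(2) ne by (simp_all add: hd_conv_nth last_conv_nth)
  have "\<forall>j\<le>i. p ! j = q ! j" if "i < n" for i
    using that
  proof (induction i)
    case 0 show ?case using start by simp
  next
    case (Suc i)
    then have same: "\<And>j. j \<le> i \<Longrightarrow> p ! j = q ! j" by simp
    have "{p ! i, p ! Suc i} \<in> cycle_edges p"
      using Suc.prems p(2) unfolding cycle_edges_def by (auto intro!: exI[of _ i])
    then obtain k where k: "k < n" "{p ! i, p ! Suc i} = {q ! k, q ! (Suc k mod n)}"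
      using q(2) unfolding e by (auto simp: cycle_edges_def)
    have inj: "\<And>a b. a < n \<Longrightarrow> b < n \<Longrightarrow> q ! a = q ! b \<Longrightarrow> a = b"
      "\<And>a b. a < n \<Longrightarrow> b < n \<Longrightarrow> p ! a = p ! b \<Longrightarrow> a = b"
      using p q by (simp_all add: nth_eq_iff_index_eq)
    have km: "Suc k mod n < n" using n by simp
    from k(2) consider "q ! i = q ! k" "p ! Suc i = q ! (Suc k mod n)"
      | "q ! i = q ! (Suc k mod n)" "p ! Suc i = q ! k"
      using same[of i] by (auto simp: doubleton_eq_iff)
    then have "p ! Suc i = q ! Suc i"
    proof cases
      case 1
      then have "i = k" using inj(1) Suc.prems k(1) by simp
      then show ?thesis using 1(2) Suc.prems by simp
    next
      case 2
      then have i: "i = Suc k mod n" using inj(1) Suc.prems km by simp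
      show ?thesis
      proof (cases "Suc k < n")
        case True
        then have "p ! Suc i = p ! k" using i same[of k] 2(2) by simp
        then show ?thesis using inj(2)[of "Suc i" k] Suc.prems True i by simp
      next
        case False
        then have "Suc k = n" using k(1) by simp
        then have k: "k = n - 1" and "i = 0" using i by auto
        then have "p ! Suc 0 = p ! (n - 1)" using 2(2) stop by simp
        then show ?thesis using inj(2)[of "Suc 0" "n - 1"] n by simp
      qed
    qed
    then show ?case using same by (auto simp: le_Suc_eq)
  qed
  then show ?thesis using p(2) q(2) n by (auto intro!: nth_equalityI)
qed

lemma cycle_edges_subset_iff:
  assumes "xs \<noteq> []"
  shows "cycle_edges xs \<subseteq> F \<longleftrightarrow> successively (\<lambda>x y. {x, y} \<in> F) xs \<and> {last xs, hd xs} \<in> F"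
proof -
  let ?n = "length xs"
  have n: "0 < ?n" using assms by simp
  have "cycle_edges xs \<subseteq> F \<longleftrightarrow> (\<forall>i<?n. {xs ! i, xs ! (Suc i mod ?n)} \<in> F)"
    by (auto simp: cycle_edges_def)
  also have "\<dots> \<longleftrightarrow> (\<forall>i. Suc i < ?n \<longrightarrow> {xs ! i, xs ! Suc i} \<in> F) \<and> {xs ! (?n - 1), xs ! 0} \<in> F"
    (is "?l \<longleftrightarrow> ?r")
  proof
    assume l: ?l
    have "{xs ! i, xs ! Suc i} \<in> F" if "Suc i < ?n" for i using l[rule_format, of i] that by simp
    moreover have "{xs ! (?n - 1), xs ! 0} \<in> F" using l[rule_format, of "?n - 1"] n by simp
    ultimately show ?r by blast
  next
    assume r: ?r
    show ?l
    proof (intro allI impI)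
      fix i assume "i < ?n"
      then show "{xs ! i, xs ! (Suc i mod ?n)} \<in> F"
        using r by (cases "?n = Suc i") auto
    qed
  qed
  finally show ?thesis using assms
    by (simp add: successively_conv_nth hd_conv_nth last_conv_nth)
qed

text \<open>
  Any edge of a cycle can be made the closing edge of its vertex list.
\<close>

lemma rotate_cycle_edges:
  assumes "i < length xs" "distinct xs"
  obtains ys where "distinct ys" "set ys = set xs" "length ys = length xs" "cycle_edges ys \<subseteq> cycle_edges xs"
    "hd ys = xs ! (Suc i mod length xs)" "last ys = xs ! i"
proof
  let ?n = "length xs" and ?ys = "rotate (Suc i) xs"
  have n: "0 < ?n" "xs \<noteq> []" using assms(1) by auto
  show "distinct ?ys" "set ?ys = set xs" "length ?ys = length xs" using assms(2) by simp_all
  show "hd ?ys = xs ! (Suc i mod ?n)" using n by (simp add: hd_rotate_conv_nth del: rotate_Suc)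
  have "last ?ys = xs ! ((Suc i + (?n - 1)) mod ?n)"
    using n by (simp add: last_conv_nth nth_rotate del: rotate_Suc)
  also have "Suc i + (?n - 1) = i + ?n" using n by simp
  also have "(i + ?n) mod ?n = i" using assms(1) by simp
  finally show "last ?ys = xs ! i" .
  have rotate1: "cycle_edges (rotate1 zs) \<subseteq> cycle_edges zs" for zs :: "'a list"
  proof (cases zs)
    case (Cons z zs')
    have "successively (\<lambda>x y. {x, y} \<in> cycle_edges zs) zs \<and> {last zs, hd zs} \<in> cycle_edges zs"
      using cycle_edges_subset_iff[of zs "cycle_edges zs"] Cons by simp
    then show ?thesis
      unfolding Cons by (cases "zs' = []") (auto simp: cycle_edges_subset_iff
          successively_append_iff successively_Cons)
  qed (simp add: cycle_edges_def)
  have "cycle_edges (rotate k xs) \<subseteq> cycle_edges xs" for k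
  proof (induction k)
    case (Suc k)
    then show ?case using rotate1[of "rotate k xs"] by (simp only: rotate_Suc)
  qed simp
  then show "cycle_edges ?ys \<subseteq> cycle_edges xs" by blast
qed

lemma is_cycle_cycle_edges:
  assumes G: "simple_graph V E" and k: "k \<ge> 3" "length xs = k"
    and xs: "distinct xs" "successively (\<lambda>x y. {x, y} \<in> E) xs" "{last xs, hd xs} \<in> E"
  shows "is_cycle V E k (cycle_edges xs)"
proof -
  have "xs \<noteq> []" using k by auto
  then have sub: "cycle_edges xs \<subseteq> E" using xs by (simp add: cycle_edges_subset_iff)
  moreover have "set xs \<subseteq> V"
  proof
    fix x assume "x \<in> set xs"
    then obtain i where "i < length xs" "x = xs ! i" by (auto simp: in_set_conv_nth)
    then have "\<exists>e \<in> cycle_edges xs. x \<in> e" unfolding cycle_edges_def by blast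
    then show "x \<in> V" using sub G by (auto simp: simple_graph_def all_edges_def)
  qed
  ultimately show ?thesis using k xs by (auto simp: is_cycle_def)
qed

text \<open>
  A cycle that appears only after adding \<open>{u, v}\<close> uses that edge; the rest of it is the path.
\<close>

lemma path_closing_cycle:
  assumes E: "\<nexists>C. is_cycle V E k C" and C: "is_cycle V (insert {u, v} E) k C"
    and "u \<noteq> v"
  obtains p where "distinct p" "length p = k" "successively (\<lambda>x y. {x, y} \<in> E) p" "hd p = u" "last p = v"
proof -
  obtain xs where k: "k \<ge> 3" and xs: "distinct xs" "length xs = k" "set xs \<subseteq> V"
    "cycle_edges xs \<subseteq> insert {u, v} E"
    using C by (auto simp: is_cycle_def)
  have "\<not> cycle_edges xs \<subseteq> E" using E k xs by (auto simp: is_cycle_def)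
  then obtain i where i: "i < length xs" "{xs ! i, xs ! (Suc i mod length xs)} = {u, v}"
    using xs(4) by (auto simp: cycle_edges_def)
  obtain ys where ys: "distinct ys" "length ys = length xs" "cycle_edges ys \<subseteq> cycle_edges xs"
    "hd ys = xs ! (Suc i mod length xs)" "last ys = xs ! i"
    using rotate_cycle_edges[OF i(1) xs(1)] by metis
  have uv: "{last ys, hd ys} = {u, v}" using ys(4,5) i(2) by simp
  have ne: "ys \<noteq> []" "3 \<le> length ys" using ys(2) xs(2) k by auto
  have "successively (\<lambda>x y. {x, y} \<in> insert {last ys, hd ys} E) ys"
    using cycle_edges_subset_iff[OF ne(1), of "insert {u, v} E"] ys(3) xs(4) uv by auto
  then have p: "successively (\<lambda>x y. {x, y} \<in> E) ys"
    unfolding successively_conv_nth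
  proof (intro allI impI)
    fix j assume all: "\<forall>j. Suc j < length ys \<longrightarrow> {ys ! j, ys ! Suc j} \<in> insert {last ys, hd ys} E"
      and j: "Suc j < length ys"
    have "{ys ! j, ys ! Suc j} \<noteq> {ys ! (length ys - 1), ys ! 0}"
      using j ne ys(1) by (auto simp: doubleton_eq_iff nth_eq_iff_index_eq)
    then show "{ys ! j, ys ! Suc j} \<in> E"
      using all j ne by (auto simp: hd_conv_nth last_conv_nth)
  qed
  from uv consider "hd ys = u" "last ys = v" | "hd ys = v" "last ys = u"
    by (auto simp: doubleton_eq_iff)
  then show thesis
  proof cases
    case 1 then show thesis using that[of ys] ys xs(2) p by simp
  next
    case 2
    have "successively (\<lambda>x y. {x, y} \<in> E) (rev ys)" using p by (simp add: insert_commute)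
    then show thesis using that[of "rev ys"] 2 ys xs(2) ne by (simp add: hd_rev last_rev)
  qed
qed

lemma uniquely_saturated_unique_eight_paths:
  assumes G: "simple_graph V E" and sat: "uniquely_cycle_saturated 9 V E"
    and no10: "\<nexists>C. is_cycle V E 10 C"
  shows "unique_eight_paths (\<lambda>x y. {x, y} \<in> E)"
proof
  have edge: "x \<in> V" "y \<in> V" "x \<noteq> y" if "{x, y} \<in> E" for x y
    using that G by (auto simp: simple_graph_def all_edges_def card_insert_if split: if_splits)
  have no9: "\<nexists>C. is_cycle V E 9 C" using sat by (simp add: uniquely_cycle_saturated_def)
  show "({x, y} \<in> E) = ({y, x} \<in> E)" for x y by (simp add: insert_commute)
  show "{x, x} \<notin> E" for x using edge by blast
  show c9: "\<not> (length p = 9 \<and> distinct p \<and> successively (\<lambda>x y. {x, y} \<in> E) p \<and> {last p, hd p} \<in> E)" for p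
    using is_cycle_cycle_edges[OF G, of 9 p] no9 by auto
  show "\<not> (length p = 10 \<and> distinct p \<and> successively (\<lambda>x y. {x, y} \<in> E) p \<and> {last p, hd p} \<in> E)" for p
    using is_cycle_cycle_edges[OF G, of 10 p] no10 by auto
  show "\<not> (length p = 9 \<and> distinct p \<and> successively (\<lambda>x y. {x, y} \<in> E) p \<and>
      length q = 9 \<and> distinct q \<and> successively (\<lambda>x y. {x, y} \<in> E) q \<and> hd p = hd q \<and> last p = last q \<and> p \<noteq> q)" for p q
  proof
    assume "length p = 9 \<and> distinct p \<and> successively (\<lambda>x y. {x, y} \<in> E) p \<and>
      length q = 9 \<and> distinct q \<and> successively (\<lambda>x y. {x, y} \<in> E) q \<and> hd p = hd q \<and> last p = last q \<and> p \<noteq> q"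
    then have p: "length p = 9" "distinct p" "successively (\<lambda>x y. {x, y} \<in> E) p"
      and q: "length q = 9" "distinct q" "successively (\<lambda>x y. {x, y} \<in> E) q"
      and pq: "hd p = hd q" "last p = last q" "p \<noteq> q" by auto
    let ?e = "{last p, hd p}"
    have ends: "p ! 0 \<in> V" "p ! 8 \<in> V" "p ! 0 \<noteq> p ! 8" "hd p = p ! 0" "last p = p ! 8"
    proof -
      have "{p ! 0, p ! 1} \<in> E" "{p ! 7, p ! 8} \<in> E"
        using p(1,3) successively_nth[of _ p 0] successively_nth[of _ p 7] by auto
      then show "p ! 0 \<in> V" "p ! 8 \<in> V" using edge by blast+
      show "p ! 0 \<noteq> p ! 8" using p by (simp add: nth_eq_iff_index_eq)
      have "p \<noteq> []" using p(1) by auto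
      then show "hd p = p ! 0" "last p = p ! 8" using p(1) by (simp_all add: hd_conv_nth last_conv_nth)
    qed
    have "?e \<in> all_edges V" using ends by (simp add: all_edges_def)
    moreover have "?e \<notin> E" using c9[of p] p by auto
    ultimately have e: "?e \<in> complement_edges V E" by (simp add: complement_edges_def)
    have G': "simple_graph V (insert ?e E)"
      using G \<open>?e \<in> all_edges V\<close> by (simp add: simple_graph_def)
    have "is_cycle V (insert ?e E) 9 (cycle_edges p)"
      using is_cycle_cycle_edges[OF G', of 9 p] p successively_mono[OF p(3)] by auto
    moreover have "is_cycle V (insert ?e E) 9 (cycle_edges q)"
      using is_cycle_cycle_edges[OF G', of 9 q] q pq successively_mono[OF q(3)] by auto
    ultimately have "cycle_edges p = cycle_edges q"
      using sat e unfolding uniquely_cycle_saturated_def by blast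
    then show False using cycle_edges_eq_imp_eq[OF p(2,1) q(2,1)] pq by simp
  qed
  show "\<exists>p. distinct p \<and> successively (\<lambda>x y. {x, y} \<in> E) p \<and> length p = 9 \<and> hd p = u \<and> last p = v"
    if "{u, u'} \<in> E" "{v, v'} \<in> E" "u \<noteq> v" "{u, v} \<notin> E" for u u' v v'
  proof -
    have "{u, v} \<in> complement_edges V E"
      using edge that by (auto simp: complement_edges_def all_edges_def)
    then obtain C where "is_cycle V (insert {u, v} E) 9 C"
      using sat unfolding uniquely_cycle_saturated_def by blast
    from path_closing_cycle[OF no9 this that(3)] show ?thesis by metis
  qed
qed

section \<open>Ears from 2-connectedness\<close>

lemma rtrancl_leaving_step:
  assumes "(u, w) \<in> R\<^sup>*" "u \<in> S" "w \<notin> S"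
  shows "\<exists>a b. (a, b) \<in> R \<and> a \<in> S \<and> b \<notin> S"
  using assms
proof (induction rule: rtrancl_induct)
  case (step y z)
  then show ?case by (cases "y \<in> S") blast+
qed simp

text \<open>
  A walk into \<open>S\<close>, shortcut at repeated vertices and stopped at its first vertex in \<open>S\<close>.
\<close>

lemma rtrancl_first_entry:
  assumes "(y, b) \<in> R\<^sup>*" "y \<notin> S" "b \<in> S"
  obtains p b' where "p \<noteq> []" "hd p = y" "distinct p" "set p \<inter> S = {}" "b' \<in> S"
    "successively (\<lambda>x y. (x, y) \<in> R) (p @ [b'])"
proof -
  have "\<exists>p b'. p \<noteq> [] \<and> hd p = y \<and> distinct p \<and> set p \<inter> S = {} \<and> b' \<in> S \<and>
    successively (\<lambda>x y. (x, y) \<in> R) (p @ [b'])"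
    using assms(1,2)
  proof (induction rule: converse_rtrancl_induct)
    case base then show ?case using assms(3) by simp
  next
    case (step y z)
    show ?case
    proof (cases "z \<in> S")
      case True
      then show ?thesis using step by (intro exI[of _ "[y]"] exI[of _ z]) auto
    next
      case False
      then obtain p b' where p: "p \<noteq> []" "hd p = z" "distinct p" "set p \<inter> S = {}" "b' \<in> S"
        "successively (\<lambda>x y. (x, y) \<in> R) (p @ [b'])"
        using step.IH by blast
      show ?thesis
      proof (cases "y \<in> set p")
        case True
        then obtain us vs where "p = us @ y # vs" by (meson split_list)
        then show ?thesis using p
          by (intro exI[of _ "y # vs"] exI[of _ b']) (auto simp: successively_append_iff)
      next
        case y: False
        then show ?thesis using p step
          by (intro exI[of _ "y # p"] exI[of _ b']) (cases p, auto simp: successively_Cons)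
      qed
    qed
  qed
  then show thesis using that by blast
qed

text \<open>
  Connectedness gives an edge leaving \<open>S\<close> at some \<open>a\<close>; since deleting \<open>a\<close> keeps the graph
  connected, one can return from there to another vertex of \<open>S\<close>.
\<close>

lemma two_connected_ear:
  assumes G: "simple_graph V E" and conn: "k_connected 2 V E"
    and S: "S \<subseteq> V" "V - S \<noteq> {}" "finite S" "card S \<ge> 2"
  obtains a b p where "a \<in> S" "b \<in> S" "a \<noteq> b" "distinct p" "p \<noteq> []" "set p \<inter> S = {}"
    "successively (\<lambda>x y. {x, y} \<in> E) (a # p @ [b])"
proof -
  have "S \<noteq> {}" using S(4) by auto
  then obtain u where u: "u \<in> S" by blast
  obtain w where w: "w \<in> V" "w \<notin> S" using S by blast
  have "connected_graph (V - {}) {e \<in> E. e \<inter> {} = {}}"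
    using conn[unfolded k_connected_def, THEN conjunct2, rule_format, of "{}"] by simp
  then have "(u, w) \<in> {(x, y). x \<in> V \<and> y \<in> V \<and> {x, y} \<in> E}\<^sup>*"
    using u w S(1) by (auto simp: connected_graph_def)
  from rtrancl_leaving_step[OF this u w(2)] obtain a y where
    a: "a \<in> S" and y: "y \<notin> S" "y \<in> V" and ay: "{a, y} \<in> E" by blast
  have "S \<noteq> {a}" using S(4) by auto
  then obtain b where b: "b \<in> S" "b \<noteq> a" using a by blast
  define R where "R = {(x, y). x \<in> V - {a} \<and> y \<in> V - {a} \<and> {x, y} \<in> {e \<in> E. e \<inter> {a} = {}}}"
  have "connected_graph (V - {a}) {e \<in> E. e \<inter> {a} = {}}"
    using conn[unfolded k_connected_def, THEN conjunct2, rule_format, of "{a}"] a S(1) by auto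
  then have "(y, b) \<in> R\<^sup>*"
    unfolding R_def using y b a S(1) by (auto simp: connected_graph_def)
  from rtrancl_first_entry[OF this y(1) b(1)] obtain p b' where
    p: "p \<noteq> []" "hd p = y" "distinct p" "set p \<inter> S = {}" "b' \<in> S"
    "successively (\<lambda>x y. (x, y) \<in> R) (p @ [b'])" .
  have "(last p, b') \<in> R" using p(1,6) by (simp add: successively_append_iff)
  then have "b' \<noteq> a" by (auto simp: R_def)
  moreover have "successively (\<lambda>x y. {x, y} \<in> E) (p @ [b'])"
    by (rule successively_mono[OF p(6)]) (auto simp: R_def)
  then have "successively (\<lambda>x y. {x, y} \<in> E) (a # p @ [b'])"
    using ay p(1,2) by (simp add: successively_Cons)
  ultimately show thesis using that[of a b' p] a p by blast
qed

theorem theorem7p13: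
  "\<not> (\<exists>(V :: 'a set) (E :: 'a set set).
        simple_graph V E \<and>
        k_connected 2 V E \<and>
        nontrivial_for_cycle 9 V \<and>
        uniquely_cycle_saturated 9 V E \<and>
        longest_even_cycle_upto 12 V E 8)"
proof
  assume "\<exists>(V :: 'a set) (E :: 'a set set).
        simple_graph V E \<and>
        k_connected 2 V E \<and>
        nontrivial_for_cycle 9 V \<and>
        uniquely_cycle_saturated 9 V E \<and>
        longest_even_cycle_upto 12 V E 8"
  then obtain V :: "'a set" and E where G: "simple_graph V E" and conn: "k_connected 2 V E"
    and V9: "card V \<ge> 9" and sat: "uniquely_cycle_saturated 9 V E"
    and long: "longest_even_cycle_upto 12 V E 8"
    by (auto simp: nontrivial_for_cycle_def)
  have "\<nexists>C. is_cycle V E 10 C"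
  proof
    assume "\<exists>C. is_cycle V E 10 C"
    moreover have "even (10::nat)" "(10::nat) \<le> 12" by simp_all
    ultimately have "10 \<le> (8::nat)" using long unfolding longest_even_cycle_upto_def by blast
    then show False by simp
  qed
  then interpret unique_eight_paths "\<lambda>x y. {x, y} \<in> E"
    by (rule uniquely_saturated_unique_eight_paths[OF G sat])
  obtain C where "is_cycle V E 8 C" using long by (auto simp: longest_even_cycle_upto_def)
  then obtain c where c: "distinct c" "length c = 8" "set c \<subseteq> V" "cycle_edges c \<subseteq> E"
    by (auto simp: is_cycle_def)
  have "c \<noteq> []" using c(2) by auto
  with c have oct: "octagon c" by (simp add: octagon_def cycle_edges_subset_iff)
  have card: "card (set c) = 8" using c distinct_card by metis
  then have "V \<noteq> set c" using V9 by auto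
  then have "V - set c \<noteq> {}" using c(3) by blast
  from two_connected_ear[OF G conn c(3) this] card obtain a b p where
    "a \<in> set c" "b \<in> set c" "a \<noteq> b" "distinct p" "p \<noteq> []"
    "set p \<inter> set c = {}"
    "successively (\<lambda>x y. {x, y} \<in> E) (a # p @ [b])" by auto
  then show False using no_ear[OF oct] by blast
qed

end
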